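(* Let $K\geq 2$ be an integer. For any two probability distributions $Q,R$ on $(0,1]^K$, the equality $\tilde{\boldsymbol{\pi}}_Q=\tilde{\boldsymbol{\pi}}_R$ is equivalent to the existence of some real number $A>0$ such that $\boldsymbol{m}_Q=A\,\boldsymbol{m}_R$.
   Context: Let $K\ge 2$, $H=\{0,1\}^K$, and $H^*=H\setminus\{(0,\ldots,0)\}$. For a probability distribution $Q$ on $(0,1]^K$, let $E_Q$ denote expectation when $(\lambda_1,\ldots,\lambda_K)\sim Q$. For $\boldsymbol{h}=(h_1,\ldots,h_K)\in H$ the cell probabilities are $$\pi_{Q,\boldsymbol{h}}=E_Q\Big\{\prod_{k=1}^K \lambda_k^{h_k}(1-\lambda_k)^{1-h_k}\Big\},$$ and the missing cell probability is $\pi_{Q,0}=\pi_{Q,(0,\ldots,0)}$. The conditional cell probabilities are $\tilde{\boldsymbol{\pi}}_Q=(\tilde{\pi}_{Q,\boldsymbol{h}})_{\boldsymbol{h}\in H^*}$ with $\tilde{\pi}_{Q,\boldsymbol{h}}=\pi_{Q,\boldsymbol{h}}/(1-\pi_{Q,0})$. (Since $Q$ lives on $(0,1]^K$, $\pi_{Q,0}<1$.) The vector of mixed moments is $\boldsymbol{m}_Q=(m_{Q,\boldsymbol{h}})_{\boldsymbol{h}\in H^*}$ with $m_{Q,\boldsymbol{h}}=E_Q\big(\prod_{k=1}^K\lambda_k^{h_k}\big)$. *)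

theory Defs
  imports "HOL-Probability.Probability"
begin

text \<open>The dimension \<open>K\<close> is the cardinality of the finite index type \<open>'k\<close>. The cube is half-open: \<open>(0,1]^K\<close>.\<close>

definition unit_cube :: "(real ^ 'k) set"
  where "unit_cube = {l. \<forall>k. 0 < l $ k \<and> l $ k \<le> 1}"

definition distr_on_cube :: "(real ^ 'k) measure \<Rightarrow> bool"
  where "distr_on_cube Q \<longleftrightarrow>
    prob_space Q \<and> sets Q = sets (restrict_space borel unit_cube)"

definition cells :: "(nat ^ 'k) set"
  where "cells = {h. \<forall>k. h $ k \<in> {0, 1}}"

definition cells_obs :: "(nat ^ 'k) set"
  where "cells_obs = cells - {0}"

text \<open>The exponent \<open>1 - h $ k\<close> is a subtraction of natural numbers; it is only meaningful
  for \<open>h \<in> cells\<close>, where no truncation occurs.\<close>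

definition cell_prob :: "(real ^ 'k) measure \<Rightarrow> nat ^ 'k \<Rightarrow> real"
  where "cell_prob Q h =
    (\<integral>l. (\<Prod>k\<in>UNIV. (l $ k) ^ (h $ k) * (1 - l $ k) ^ (1 - h $ k)) \<partial>Q)"

definition cond_cell_prob :: "(real ^ 'k) measure \<Rightarrow> nat ^ 'k \<Rightarrow> real"
  where "cond_cell_prob Q h = cell_prob Q h / (1 - cell_prob Q 0)"

definition mixed_moment :: "(real ^ 'k) measure \<Rightarrow> nat ^ 'k \<Rightarrow> real"
  where "mixed_moment Q h = (\<integral>l. (\<Prod>k\<in>UNIV. (l $ k) ^ (h $ k)) \<partial>Q)"

end

theory Submission
  imports Defs
begin

text \<open>
  Identify a cell with the set \<open>S\<close> of coordinates in which it is \<open>1\<close>. Expanding the products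
  \<open>\<Prod>k\<in>-S. (l\<^sub>k + (1 - l\<^sub>k))\<close> and \<open>\<Prod>k\<in>-S. (1 - l\<^sub>k)\<close> and integrating shows
  that the moment of \<open>S\<close> is the sum of the probabilities of all cells above \<open>S\<close>, and conversely
  that the probability of \<open>S\<close> is an alternating sum of the moments above \<open>S\<close>
  (\<open>mixed_moment_eq_sum_cell_prob\<close> and \<open>cell_prob_eq_sum_mixed_moment\<close>).
  This Moebius inversion on the Boolean lattice never leaves the upper set of \<open>S\<close>; so if
  \<open>S\<close> is nonempty, the empty cell is not involved, and moments of observable cells
  and probabilities of observable cells determine one another by mutually inverse linear maps that
  do not depend on the distribution. Hence the moments of \<open>Q\<close> and \<open>R\<close> are proportional with
  factor \<open>A\<close> iff the observable cell probabilities are (\<open>mixed_moment_scaled_iff_cell_prob_scaled\<close>).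

  It remains to compare proportionality with equality of conditional cell probabilities. If the
  latter are equal, the factor is the quotient of the two observation probabilities
  \<open>1 - cell_prob Q 0\<close> and \<open>1 - cell_prob R 0\<close>, which are positive because no capture probability
  is \<open>0\<close>. Conversely, each observation probability is the sum of the observable
  cell probabilities, so it scales by the same \<open>A\<close>, and \<open>A\<close> cancels in the quotient.
\<close>

definition cell_of_set :: "'k set \<Rightarrow> nat ^ 'k"
  where "cell_of_set S = (\<chi> k. if k \<in> S then 1 else 0)"

lemma cell_of_set_empty: "cell_of_set {} = 0"
  by (simp add: cell_of_set_def vec_eq_iff)

lemma cells_obs_eq_image: "cells_obs = cell_of_set ` (- {{}})"
proof (rule set_eqI, rule iffI)
  fix h :: "nat ^ 'k"
  assume h: "h \<in> cells_obs"
  have "h = cell_of_set {k. h $ k = 1}"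
    using h by (auto simp: cells_obs_def cells_def cell_of_set_def vec_eq_iff)
  moreover have "{k. h $ k = 1} \<noteq> {}"
    using h calculation cell_of_set_empty unfolding cells_obs_def by (metis DiffD2 singletonI)
  ultimately show "h \<in> cell_of_set ` (- {{}})" by blast
next
  fix h :: "nat ^ 'k"
  assume "h \<in> cell_of_set ` (- {{}})"
  then show "h \<in> cells_obs"
    by (auto simp: cells_obs_def cells_def cell_of_set_def vec_eq_iff)
qed

lemma prod_power_cell_of_set:
  fixes l :: "real ^ 'k"
  shows "(\<Prod>k\<in>UNIV. (l $ k) ^ (cell_of_set S $ k)) = (\<Prod>k\<in>S. l $ k)"
proof -
  have "(\<Prod>k\<in>UNIV. (l $ k) ^ (cell_of_set S $ k)) = (\<Prod>k\<in>UNIV. if k \<in> S then l $ k else 1)"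
    by (intro prod.cong) (auto simp: cell_of_set_def)
  then show ?thesis
    by (simp add: prod.If_cases)
qed

lemma prod_cell_prob_integrand:
  fixes l :: "real ^ 'k"
  shows "(\<Prod>k\<in>UNIV. (l $ k) ^ (cell_of_set S $ k) * (1 - l $ k) ^ (1 - cell_of_set S $ k)) =
    (\<Prod>k\<in>S. l $ k) * (\<Prod>k\<in>-S. 1 - l $ k)"
proof -
  have "(\<Prod>k\<in>UNIV. (l $ k) ^ (cell_of_set S $ k) * (1 - l $ k) ^ (1 - cell_of_set S $ k)) =
    (\<Prod>k\<in>UNIV. if k \<in> S then l $ k else 1 - l $ k)"
    by (intro prod.cong) (auto simp: cell_of_set_def)
  then show ?thesis
    by (simp add: prod.If_cases Collect_neg_eq[symmetric])
qed

lemma mixed_moment_cell_of_set: "mixed_moment Q (cell_of_set S) = (\<integral>l. (\<Prod>k\<in>S. l $ k) \<partial>Q)"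
  by (simp add: mixed_moment_def prod_power_cell_of_set)

lemma cell_prob_cell_of_set:
  "cell_prob Q (cell_of_set S) = (\<integral>l. (\<Prod>k\<in>S. l $ k) * (\<Prod>k\<in>-S. 1 - l $ k) \<partial>Q)"
  unfolding cell_prob_def prod_cell_prob_integrand by (rule refl)

text \<open>Multiply by \<open>1 = (\<Prod>k\<in>-S. l $ k + (1 - l $ k))\<close> and expand: each \<open>T\<close> collects the
  coordinates outside \<open>S\<close> from which the summand \<open>l $ k\<close> is taken.\<close>

lemma monomial_eq_sum_cells:
  fixes l :: "real ^ 'k"
  shows "(\<Prod>k\<in>S. l $ k) =
    (\<Sum>T\<in>Pow (-S). (\<Prod>k\<in>S \<union> T. l $ k) * (\<Prod>k\<in>-(S \<union> T). 1 - l $ k))"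
proof -
  have "(\<Prod>k\<in>S. l $ k) = (\<Prod>k\<in>S. l $ k) * (\<Prod>k\<in>-S. l $ k + (1 - l $ k))"
    by simp
  also have "\<dots> = (\<Sum>T\<in>Pow (-S). (\<Prod>k\<in>S. l $ k) * ((\<Prod>k\<in>T. l $ k) * (\<Prod>k\<in>-S - T. 1 - l $ k)))"
    by (subst prod_add) (auto simp: sum_distrib_left)
  also have "\<dots> = (\<Sum>T\<in>Pow (-S). (\<Prod>k\<in>S \<union> T. l $ k) * (\<Prod>k\<in>-(S \<union> T). 1 - l $ k))"
  proof (rule sum.cong)
    fix T assume "T \<in> Pow (-S)"
    then have "(\<Prod>k\<in>S \<union> T. l $ k) = (\<Prod>k\<in>S. l $ k) * (\<Prod>k\<in>T. l $ k)"
      by (intro prod.union_disjoint) auto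
    moreover have "-(S \<union> T) = -S - T" by auto
    ultimately show "(\<Prod>k\<in>S. l $ k) * ((\<Prod>k\<in>T. l $ k) * (\<Prod>k\<in>-S - T. 1 - l $ k)) =
      (\<Prod>k\<in>S \<union> T. l $ k) * (\<Prod>k\<in>-(S \<union> T). 1 - l $ k)"
      by simp
  qed simp
  finally show ?thesis .
qed

text \<open>Inclusion--exclusion: \<open>T\<close> collects the factors \<open>1 - l $ k\<close> that contribute \<open>- l $ k\<close>.\<close>

lemma cell_eq_sum_monomials:
  fixes l :: "real ^ 'k"
  shows "(\<Prod>k\<in>S. l $ k) * (\<Prod>k\<in>-S. 1 - l $ k) =
    (\<Sum>T\<in>Pow (-S). (-1) ^ card T * (\<Prod>k\<in>S \<union> T. l $ k))"
proof -
  have "(\<Prod>k\<in>-S. 1 - l $ k) = (\<Prod>k\<in>-S. - (l $ k) + 1)"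
    by simp
  also have "\<dots> = (\<Sum>T\<in>Pow (-S). (-1) ^ card T * (\<Prod>k\<in>T. l $ k))"
    by (subst prod_add) (auto simp: prod_uminus)
  finally have "(\<Prod>k\<in>S. l $ k) * (\<Prod>k\<in>-S. 1 - l $ k) =
      (\<Sum>T\<in>Pow (-S). (-1) ^ card T * ((\<Prod>k\<in>S. l $ k) * (\<Prod>k\<in>T. l $ k)))"
    by (simp add: sum_distrib_left mult_ac)
  also have "\<dots> = (\<Sum>T\<in>Pow (-S). (-1) ^ card T * (\<Prod>k\<in>S \<union> T. l $ k))"
    by (intro sum.cong refl arg_cong2[where f = "(*)"] prod.union_disjoint[symmetric]) auto
  finally show ?thesis .
qed

lemma space_distr_on_cube: "distr_on_cube Q \<Longrightarrow> space Q = unit_cube"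
  using sets_eq_imp_space_eq[of Q "restrict_space borel unit_cube"]
  by (simp add: distr_on_cube_def space_restrict_space)

lemma integrable_monomial:
  fixes Q :: "(real ^ 'k) measure"
  assumes "distr_on_cube Q"
  shows "integrable Q (\<lambda>l. \<Prod>k\<in>S. l $ k)"
proof -
  interpret prob_space Q using assms by (simp add: distr_on_cube_def)
  have "(\<lambda>l. \<Prod>k\<in>S. l $ k) \<in> borel_measurable (restrict_space borel (unit_cube :: (real ^ 'k) set))"
    by (intro measurable_restrict_space1 borel_measurable_continuous_onI continuous_intros)
  moreover have "sets Q = sets (restrict_space borel unit_cube)"
    using assms by (simp add: distr_on_cube_def)
  ultimately have "(\<lambda>l. \<Prod>k\<in>S. l $ k) \<in> borel_measurable Q"
    by (simp cong: measurable_cong_sets)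
  moreover have "norm (\<Prod>k\<in>S. l $ k) \<le> 1" if "l \<in> space Q" for l
  proof -
    have "0 \<le> l $ k \<and> l $ k \<le> 1" for k
      using that space_distr_on_cube[OF assms] by (auto simp: unit_cube_def less_imp_le)
    then show ?thesis
      by (simp add: abs_prod prod_le_1)
  qed
  ultimately show ?thesis
    by (intro integrable_const_bound[where B = 1]) auto
qed

lemma integrable_cell:
  fixes Q :: "(real ^ 'k) measure"
  assumes "distr_on_cube Q"
  shows "integrable Q (\<lambda>l. (\<Prod>k\<in>S. l $ k) * (\<Prod>k\<in>-S. 1 - l $ k))"
  unfolding cell_eq_sum_monomials using integrable_monomial[OF assms] by auto

lemma mixed_moment_eq_sum_cell_prob:
  fixes Q :: "(real ^ 'k) measure"
  assumes "distr_on_cube Q"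
  shows "mixed_moment Q (cell_of_set S) = (\<Sum>T\<in>Pow (-S). cell_prob Q (cell_of_set (S \<union> T)))"
  unfolding mixed_moment_cell_of_set cell_prob_cell_of_set
  by (subst monomial_eq_sum_cells) (simp only: Bochner_Integration.integral_sum integrable_cell[OF assms])

lemma cell_prob_eq_sum_mixed_moment:
  fixes Q :: "(real ^ 'k) measure"
  assumes "distr_on_cube Q"
  shows "cell_prob Q (cell_of_set S) =
    (\<Sum>T\<in>Pow (-S). (-1) ^ card T * mixed_moment Q (cell_of_set (S \<union> T)))"
  unfolding mixed_moment_cell_of_set cell_prob_cell_of_set cell_eq_sum_monomials
  by (simp add: integrable_monomial[OF assms])

text \<open>Both inversion formulas for a nonempty \<open>S\<close> involve only supersets of \<open>S\<close>, hence only
  observable cells, and they are linear, so a common factor passes through them.\<close>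

lemma mixed_moment_scaled_iff_cell_prob_scaled:
  fixes Q R :: "(real ^ 'k) measure"
  assumes Q: "distr_on_cube Q" and R: "distr_on_cube R"
  shows "(\<forall>h\<in>cells_obs. mixed_moment Q h = A * mixed_moment R h) \<longleftrightarrow>
    (\<forall>h\<in>cells_obs. cell_prob Q h = A * cell_prob R h)"
proof -
  have "(\<forall>S. S \<noteq> {} \<longrightarrow> mixed_moment Q (cell_of_set S) = A * mixed_moment R (cell_of_set S)) \<longleftrightarrow>
    (\<forall>S. S \<noteq> {} \<longrightarrow> cell_prob Q (cell_of_set S) = A * cell_prob R (cell_of_set S))"
  proof (intro iffI allI impI)
    fix S :: "'k set"
    assume "\<forall>S. S \<noteq> {} \<longrightarrow> mixed_moment Q (cell_of_set S) = A * mixed_moment R (cell_of_set S)"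
      and "S \<noteq> {}"
    then show "cell_prob Q (cell_of_set S) = A * cell_prob R (cell_of_set S)"
      by (simp add: cell_prob_eq_sum_mixed_moment Q R sum_distrib_left mult_ac)
  next
    fix S :: "'k set"
    assume "\<forall>S. S \<noteq> {} \<longrightarrow> cell_prob Q (cell_of_set S) = A * cell_prob R (cell_of_set S)"
      and "S \<noteq> {}"
    then show "mixed_moment Q (cell_of_set S) = A * mixed_moment R (cell_of_set S)"
      by (simp add: mixed_moment_eq_sum_cell_prob Q R sum_distrib_left)
  qed
  then show ?thesis
    by (auto simp: cells_obs_eq_image)
qed

text \<open>The instance \<open>S = {}\<close> of the moment expansion: the moment of the empty monomial is the
  total mass \<open>1\<close>.\<close>

lemma one_minus_missing_cell_prob:
  fixes Q :: "(real ^ 'k) measure"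
  assumes "distr_on_cube Q"
  shows "1 - cell_prob Q 0 = (\<Sum>S\<in>-{{}}. cell_prob Q (cell_of_set S))"
proof -
  interpret prob_space Q using assms by (simp add: distr_on_cube_def)
  have "1 = mixed_moment Q (cell_of_set {})"
    by (simp add: mixed_moment_cell_of_set prob_space)
  also have "\<dots> = (\<Sum>S\<in>UNIV. cell_prob Q (cell_of_set S))"
    by (simp add: mixed_moment_eq_sum_cell_prob[OF assms])
  also have "\<dots> = cell_prob Q (cell_of_set {}) + (\<Sum>S\<in>-{{}}. cell_prob Q (cell_of_set S))"
    by (subst sum.remove[of _ "{}"]) (auto simp: Compl_eq_Diff_UNIV)
  finally show ?thesis
    by (simp add: cell_of_set_empty)
qed

text \<open>On \<open>unit_cube\<close> every factor \<open>1 - l $ k\<close> lies in \<open>[0,1)\<close>, so the integrand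
  of the missing cell is pointwise smaller than \<open>1\<close>.\<close>

lemma missing_cell_prob_less_1:
  fixes Q :: "(real ^ 'k) measure"
  assumes "distr_on_cube Q"
  shows "cell_prob Q 0 < 1"
proof -
  interpret prob_space Q using assms by (simp add: distr_on_cube_def)
  let ?f = "\<lambda>l :: real ^ 'k. \<Prod>k\<in>UNIV. 1 - l $ k"
  have less_1: "?f l < 1" if "l \<in> space Q" for l
  proof -
    have l: "0 < l $ k \<and> l $ k \<le> 1" for k
      using that space_distr_on_cube[OF assms] by (auto simp: unit_cube_def)
    \<comment> \<open>One factor below \<open>1\<close> suffices; any coordinate will do, and the index type is nonempty.\<close>
    let ?j = "undefined :: 'k"
    have "?f l = (1 - l $ ?j) * (\<Prod>k\<in>UNIV - {?j}. 1 - l $ k)"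
      by (simp add: prod.remove)
    also have "\<dots> \<le> (1 - l $ ?j) * 1"
      using l by (intro mult_left_mono prod_le_1) (auto simp: less_imp_le)
    also have "\<dots> < 1" using l by simp
    finally show ?thesis .
  qed
  have "integrable Q ?f"
    using integrable_cell[OF assms, of "{}"] by simp
  then have "(\<integral>l. ?f l \<partial>Q) < (\<integral>l. 1 \<partial>Q)"
    using less_1 by (intro integral_less_AE_space) (auto simp: emeasure_space_1)
  then show ?thesis
    using cell_prob_cell_of_set[of Q "{}"] by (simp add: cell_of_set_empty prob_space)
qed

theorem theorem1:
  fixes Q R :: "(real ^ 'k) measure"
  assumes "CARD('k) \<ge> 2"
    and "distr_on_cube Q"
    and "distr_on_cube R"
  shows "(\<forall>h\<in>cells_obs. cond_cell_prob Q h = cond_cell_prob R h) \<longleftrightarrow>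
    (\<exists>A::real. A > 0 \<and> (\<forall>h\<in>cells_obs. mixed_moment Q h = A * mixed_moment R h))"
proof -
  note Q = assms(2) and R = assms(3)
  have pos: "0 < 1 - cell_prob Q 0" "0 < 1 - cell_prob R 0"
    using missing_cell_prob_less_1[OF Q] missing_cell_prob_less_1[OF R] by simp_all
  have "(\<forall>h\<in>cells_obs. cond_cell_prob Q h = cond_cell_prob R h) \<longleftrightarrow>
    (\<exists>A>0. \<forall>h\<in>cells_obs. cell_prob Q h = A * cell_prob R h)"
  proof
    assume eq: "\<forall>h\<in>cells_obs. cond_cell_prob Q h = cond_cell_prob R h"
    let ?A = "(1 - cell_prob Q 0) / (1 - cell_prob R 0)"
    have "cell_prob Q h = ?A * cell_prob R h" if "h \<in> cells_obs" for h
      using eq[rule_format, OF that] pos by (simp add: cond_cell_prob_def field_simps)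
    moreover have "0 < ?A" using pos by simp
    ultimately show "\<exists>A>0. \<forall>h\<in>cells_obs. cell_prob Q h = A * cell_prob R h" by blast
  next
    assume "\<exists>A>0. \<forall>h\<in>cells_obs. cell_prob Q h = A * cell_prob R h"
    then obtain A where A: "A > 0" and scaled: "\<forall>h\<in>cells_obs. cell_prob Q h = A * cell_prob R h"
      by blast
    have "1 - cell_prob Q 0 = A * (1 - cell_prob R 0)"
      unfolding one_minus_missing_cell_prob[OF Q] one_minus_missing_cell_prob[OF R] sum_distrib_left
      using scaled by (intro sum.cong) (auto simp: cells_obs_eq_image)
    then show "\<forall>h\<in>cells_obs. cond_cell_prob Q h = cond_cell_prob R h"
      using A scaled by (simp add: cond_cell_prob_def)
  qed
  then show ?thesis
    by (simp add: mixed_moment_scaled_iff_cell_prob_scaled[OF Q R])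
qed

end
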